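(* Let $R$ be a commutative Noetherian ring that is a unique factorization domain, and let $I$ and $J$ be principal ideals of $R$. Then the intersection algebra $\mathcal{B}=\mathcal{B}_R(I,J)$ of $I$ and $J$ is finitely generated as an algebra over $R$.
   Context: $\mathbb{N}$ denotes the non-negative integers. For ideals $I,J$ of a commutative Noetherian ring $R$, the intersection algebra of $I$ and $J$ is the $\mathbb{N}^2$-graded $R$-subalgebra $$\mathcal{B}_R(I,J)=\sum_{r,s\in\mathbb{N}}(I^r\cap J^s)\,u^rv^s\subseteq R[u,v]$$ of the polynomial ring $R[u,v]$ in two indeterminates $u,v$, where $I^0=J^0=R$. *)

theory Defs
  imports
    "HOL-Algebra.UnivPoly"
    "HOL-Algebra.Ring_Divisibility"
    "HOL-Algebra.Ideal_Product"
    "HOL-Algebra.Generated_Rings"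
begin

text \<open>
  The polynomial ring \<open>R[u,v]\<close> is realized as \<open>R[u][v]\<close>: the inner indeterminate is \<open>u\<close>,
  the outer one is \<open>v\<close>.
\<close>

abbreviation UP2 :: "('a, 'm) ring_scheme \<Rightarrow> (nat \<Rightarrow> 'a, nat \<Rightarrow> nat \<Rightarrow> 'a) up_ring" where
  "UP2 R \<equiv> UP (UP R)"

text \<open>\<open>monom2 R a r s\<close> is \<open>a u\<^sup>r v\<^sup>s\<close>.\<close>

definition monom2 :: "('a, 'm) ring_scheme \<Rightarrow> 'a \<Rightarrow> nat \<Rightarrow> nat \<Rightarrow> (nat \<Rightarrow> nat \<Rightarrow> 'a)" where
  "monom2 R a r s = monom (UP2 R) (monom (UP R) a r) s"

text \<open>
  The power is taken in the multiplicative monoid of ideals, whose unit is \<open>carrier R\<close>;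
  in particular \<open>I\<^sup>0 = R\<close> for every ideal \<open>I\<close>, including the zero ideal.
\<close>

definition ideal_pow :: "('a, 'm) ring_scheme \<Rightarrow> 'a set \<Rightarrow> nat \<Rightarrow> 'a set" where
  "ideal_pow R I n = I [^]\<^bsub>ideals_set R\<^esub> n"

text \<open>
  The sum of the \<open>R\<close>-submodules \<open>(I\<^sup>r \<inter> J\<^sup>s) u\<^sup>r v\<^sup>s\<close> of \<open>R[u,v]\<close>: its elements are the finite sums of
  elements of the summands. Each summand is closed under addition, so one term for each
  bidegree \<open>(r, s)\<close> suffices.
\<close>

definition intersection_algebra ::
    "('a, 'm) ring_scheme \<Rightarrow> 'a set \<Rightarrow> 'a set \<Rightarrow> (nat \<Rightarrow> nat \<Rightarrow> 'a) set" where
  "intersection_algebra R I J =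
     {finsum (UP2 R) (\<lambda>(r, s). monom2 R (c r s) r s) F | F c.
        finite F \<and> (\<forall>(r, s)\<in>F. c r s \<in> ideal_pow R I r \<inter> ideal_pow R J s)}"

text \<open>
  The \<open>R\<close>-subalgebra of \<open>R[u,v]\<close> generated by \<open>S\<close> is the subring generated by \<open>S\<close> together with
  the constant polynomials.
\<close>

definition subalgebra_generated ::
    "('a, 'm) ring_scheme \<Rightarrow> (nat \<Rightarrow> nat \<Rightarrow> 'a) set \<Rightarrow> (nat \<Rightarrow> nat \<Rightarrow> 'a) set" where
  "subalgebra_generated R S =
     generate_ring (UP2 R) ((\<lambda>a. monom2 R a 0 0) ` carrier R \<union> S)"

definition finitely_generated_algebra ::
    "('a, 'm) ring_scheme \<Rightarrow> (nat \<Rightarrow> nat \<Rightarrow> 'a) set \<Rightarrow> bool" where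
  "finitely_generated_algebra R B \<longleftrightarrow>
     (\<exists>S. finite S \<and> S \<subseteq> B \<and> B = subalgebra_generated R S)"

end

theory Submission
  imports Defs
begin

text \<open>
  Let \<open>I = (a)\<close> and \<open>J = (b)\<close>. In a unique factorization domain, when \<open>a\<close> and \<open>b\<close> are nonzero, the
  ideal \<open>I\<^sup>r \<inter> J\<^sup>s\<close> is again principal, generated by a least common multiple \<open>g r s\<close> of \<open>a\<^sup>r\<close> and \<open>b\<^sup>s\<close>.
  If a prime \<open>p\<close> has exponents \<open>\<alpha>\<^sub>p \<ge> 0\<close> in \<open>a\<close> and \<open>\<beta>\<^sub>p \<ge> 0\<close> in \<open>b\<close>, then the exponent of \<open>p\<close> in
  \<open>g r s\<close> is \<open>max (r \<alpha>\<^sub>p) (s \<beta>\<^sub>p)\<close>. This function of \<open>(r, s)\<close> is linear on either side of the ray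
  \<open>r \<alpha>\<^sub>p = s \<beta>\<^sub>p\<close>. The finitely many rays that belong to the primes dividing \<open>a\<close> or \<open>b\<close> cut \<open>\<nat>\<^sup>2\<close> into
  finitely many cones, and on each cone \<open>(r, s) \<mapsto> g r s\<close> is multiplicative up to units. Each cone is
  a finitely generated monoid, so the monomials \<open>g r s u\<^sup>r v\<^sup>s\<close> with \<open>(r, s)\<close> a generator of one of
  the cones generate the algebra.

  The cones need not be handled one by one. Attach to \<open>(r, s)\<close> the natural numbers \<open>r\<close>, \<open>s\<close> and,
  for each of the primes, the positive and the negative part of \<open>r \<alpha>\<^sub>p - s \<beta>\<^sub>p\<close>. If
  \<open>(r\<^sub>1, s\<^sub>1)\<close> is below \<open>(r, s)\<close> in all these coordinates, then \<open>(r\<^sub>1, s\<^sub>1)\<close> and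
  \<open>(r - r\<^sub>1, s - s\<^sub>1)\<close> lie in a common closed cone with \<open>(r, s)\<close>. Hence every nonzero pair is either
  minimal or splits into two nonzero pairs along which \<open>g\<close> is multiplicative, and Dickson's lemma
  says that there are only finitely many minimal pairs (\<open>union_repeat_mset_decomposition\<close>). The
  algebraic consequence of such a splitting, \<open>finitely_generated_bigraded_sum\<close>, is an induction on
  \<open>r + s\<close>.

  If \<open>a = 0\<close> or \<open>b = 0\<close>, then \<open>I\<^sup>r \<inter> J\<^sup>s = (a\<^sup>r b\<^sup>s)\<close>; here the generator is multiplicative on all
  of \<open>\<nat>\<^sup>2\<close>, and the bidegrees \<open>(1, 0)\<close> and \<open>(0, 1)\<close> suffice.
\<close>

section \<open>Dickson's lemma\<close>

lemma nat_incseq_subsequence: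
  fixes x :: "nat \<Rightarrow> nat"
  obtains \<theta> where "strict_mono \<theta>" "incseq (\<lambda>n. x (\<theta> n))"
proof -
  obtain f where f: "strict_mono f" "monoseq (\<lambda>n. x (f n))"
    using seq_monosub by blast
  show thesis
  proof (cases "incseq (\<lambda>n. x (f n))")
    case True
    with f(1) that show thesis by blast
  next
    case False
    with f(2) have dec: "decseq (\<lambda>n. x (f n))"
      by (simp add: monoseq_iff)
    obtain N where N: "\<And>n. x (f N) \<le> x (f n)"
      using ex_has_least_nat[of "\<lambda>_. True" 0 "\<lambda>n. x (f n)"] by auto
    have "x (f (N + n)) = x (f N)" for n
      by (rule antisym) (use dec N in \<open>auto simp: decseq_def\<close>)
    then have "incseq (\<lambda>n. x (f (N + n)))"
      by (simp add: incseq_def)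
    moreover have "strict_mono (\<lambda>n. f (N + n))"
      using f(1) by (simp add: strict_mono_def)
    ultimately show thesis by (rule that[rotated])
  qed
qed

text \<open>
  Passing to a subsequence preserves the monotonicity already achieved, so the coordinates can be
  treated one after the other.
\<close>
lemma simultaneous_incseq_subsequence:
  fixes \<Phi> :: "('x \<Rightarrow> nat) set" and \<sigma> :: "nat \<Rightarrow> 'x"
  assumes "finite \<Phi>"
  shows "\<exists>\<theta>. strict_mono \<theta> \<and> (\<forall>\<phi>\<in>\<Phi>. incseq (\<lambda>n. \<phi> (\<sigma> (\<theta> n))))"
  using assms
proof induction
  case empty
  show ?case by (auto intro: exI[of _ id] simp: strict_mono_def)
next
  case (insert \<psi> \<Phi>)
  then obtain \<theta> where \<theta>: "strict_mono \<theta>" "\<forall>\<phi>\<in>\<Phi>. incseq (\<lambda>n. \<phi> (\<sigma> (\<theta> n)))"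
    by blast
  obtain \<eta> where \<eta>: "strict_mono \<eta>" "incseq (\<lambda>n. \<psi> (\<sigma> (\<theta> (\<eta> n))))"
    using nat_incseq_subsequence[of "\<lambda>n. \<psi> (\<sigma> (\<theta> n))"] by blast
  have "mono \<eta>" using \<eta>(1) by (rule strict_mono_mono)
  then have "\<forall>\<phi>\<in>insert \<psi> \<Phi>. incseq (\<lambda>n. \<phi> (\<sigma> ((\<theta> \<circ> \<eta>) n)))"
    using \<theta>(2) \<eta>(2) by (auto simp: monotone_def)
  moreover have "strict_mono (\<theta> \<circ> \<eta>)"
    using \<theta>(1) \<eta>(1) by (rule strict_mono_o)
  ultimately show ?case by blast
qed

text \<open>
  Dickson's lemma for the quasi-order that compares elements in finitely many natural-number
  coordinates: along an infinite sequence of distinct minimal elements some subsequence would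
  increase in every coordinate, so its second term could not be minimal.
\<close>
lemma finite_minimal_elements:
  fixes \<Phi> :: "('x \<Rightarrow> nat) set" and S :: "'x set"
  assumes "finite \<Phi>"
  shows "finite {x \<in> S. \<forall>y\<in>S. (\<forall>\<phi>\<in>\<Phi>. \<phi> y \<le> \<phi> x) \<longrightarrow> y = x}" (is "finite ?M")
proof (rule ccontr)
  assume "infinite ?M"
  then obtain \<sigma> :: "nat \<Rightarrow> 'x" where \<sigma>: "inj \<sigma>" "range \<sigma> \<subseteq> ?M"
    using infinite_countable_subset by blast
  obtain \<theta> where \<theta>: "strict_mono \<theta>" "\<forall>\<phi>\<in>\<Phi>. incseq (\<lambda>n. \<phi> (\<sigma> (\<theta> n)))"
    using simultaneous_incseq_subsequence[OF assms] by blast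
  have "\<forall>\<phi>\<in>\<Phi>. \<phi> (\<sigma> (\<theta> 0)) \<le> \<phi> (\<sigma> (\<theta> 1))"
    using \<theta>(2) by (auto simp: incseq_def)
  then have "\<sigma> (\<theta> 0) = \<sigma> (\<theta> 1)"
    using \<sigma>(2) by blast
  then have "\<theta> 0 = \<theta> 1" using \<sigma>(1) by (simp add: inj_eq)
  then show False using strict_monoD[OF \<theta>(1), of 0 1] by simp
qed

section \<open>Splitting unions of multiples of multisets\<close>

text \<open>
  The hypotheses bound the positive and the negative part of \<open>x - y\<close> by those of the sum
  of \<open>x - y\<close> and \<open>x' - y'\<close>, so the two differences have compatible signs and the same
  argument attains both maxima on the right.
\<close>

lemma max_split:
  fixes x y x' y' :: nat
  assumes "x - y \<le> (x + x') - (y + y')" "y - x \<le> (y + y') - (x + x')"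
  shows "max (x + x') (y + y') = max x y + max x' y'"
  using assms by linarith

text \<open>
  The combinatorial core: \<open>A\<close> and \<open>B\<close> stand for the prime factorizations of \<open>a\<close> and \<open>b\<close>, and
  \<open>L r s\<close> for that of the least common multiple of \<open>a\<^sup>r\<close> and \<open>b\<^sup>s\<close>. The set \<open>H\<close> consists of the
  minimal nonzero pairs for the coordinates \<open>r\<close>, \<open>s\<close> and the parts of
  \<open>r \<cdot> count A p - s \<cdot> count B p\<close>.
\<close>
lemma union_repeat_mset_decomposition:
  fixes A B :: "'b multiset"
  defines "L \<equiv> \<lambda>r s. repeat_mset r A \<union># repeat_mset s B"
  obtains H :: "(nat \<times> nat) set" where "finite H"
    and "\<And>r s. \<lbrakk>(r, s) \<notin> H; (r, s) \<noteq> (0, 0)\<rbrakk> \<Longrightarrow>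
           \<exists>r1 s1 r2 s2. (r1, s1) \<noteq> (0, 0) \<and> (r2, s2) \<noteq> (0, 0) \<and>
             r = r1 + r2 \<and> s = s1 + s2 \<and> L r s = L r1 s1 + L r2 s2"
proof -
  \<comment> \<open>Truncated subtraction of naturals yields the positive and the negative part.\<close>
  define \<Phi> :: "(nat \<times> nat \<Rightarrow> nat) set" where
    "\<Phi> = {fst, snd} \<union>
       (\<Union>p\<in>set_mset (A + B).
          {\<lambda>(r, s). r * count A p - s * count B p, \<lambda>(r, s). s * count B p - r * count A p})"
  define S :: "(nat \<times> nat) set" where "S = UNIV - {(0, 0)}"
  define H where "H = {x \<in> S. \<forall>y\<in>S. (\<forall>\<phi>\<in>\<Phi>. \<phi> y \<le> \<phi> x) \<longrightarrow> y = x}"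
  have "finite H" unfolding H_def by (rule finite_minimal_elements) (simp add: \<Phi>_def)
  moreover have "\<exists>r1 s1 r2 s2. (r1, s1) \<noteq> (0, 0) \<and> (r2, s2) \<noteq> (0, 0) \<and>
             r = r1 + r2 \<and> s = s1 + s2 \<and> L r s = L r1 s1 + L r2 s2"
    if rs: "(r, s) \<notin> H" "(r, s) \<noteq> (0, 0)" for r s
  proof -
    from rs obtain y where y: "y \<in> S" "y \<noteq> (r, s)" "\<forall>\<phi>\<in>\<Phi>. \<phi> y \<le> \<phi> (r, s)"
      unfolding H_def S_def by blast
    obtain r1 s1 where "y = (r1, s1)" by fastforce
    with y have 1: "(r1, s1) \<noteq> (0, 0)" "(r1, s1) \<noteq> (r, s)"
      and le: "\<forall>\<phi>\<in>\<Phi>. \<phi> (r1, s1) \<le> \<phi> (r, s)"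
      by (simp_all add: S_def)
    have "r1 \<le> r" "s1 \<le> s"
      using le by (auto simp: \<Phi>_def)
    then obtain r2 s2 where 2: "r = r1 + r2" "s = s1 + s2"
      by (meson le_Suc_ex)
    have "L r s = L r1 s1 + L r2 s2"
    proof (rule multiset_eqI)
      fix p
      show "count (L r s) p = count (L r1 s1 + L r2 s2) p"
      proof (cases "p \<in># A + B")
        case True
        then have "(\<lambda>(r, s). r * count A p - s * count B p) \<in> \<Phi>"
          and "(\<lambda>(r, s). s * count B p - r * count A p) \<in> \<Phi>"
          unfolding \<Phi>_def by blast+
        from this[THEN bspec[OF le]]
        have "r1 * count A p - s1 * count B p \<le> r * count A p - s * count B p"
          and "s1 * count B p - r1 * count A p \<le> s * count B p - r * count A p"
          by simp_all
        then show ?thesis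
          unfolding 2 L_def by (simp add: distrib_right max_split)
      next
        case False
        then show ?thesis by (simp add: L_def not_in_iff)
      qed
    qed
    moreover have "(r2, s2) \<noteq> (0, 0)" using 1(2) 2 by auto
    ultimately show ?thesis using 1(1) 2 by blast
  qed
  ultimately show thesis by (rule that)
qed

section \<open>The factorization of an element as a multiset\<close>

text \<open>
  The multiset of association classes of irreducible factors does not depend on the chosen
  factorization. It turns divisibility into inclusion and least common multiples into unions.
\<close>

definition factor_mset :: "('a, 'b) monoid_scheme \<Rightarrow> 'a \<Rightarrow> 'a set multiset" where
  "factor_mset G x = fmset G (SOME fs. set fs \<subseteq> carrier G \<and> wfactors G fs x)"

context factorial_monoid
begin

lemma factor_mset_eq:
  assumes "x \<in> carrier G" "set fs \<subseteq> carrier G" "wfactors G fs x"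
  shows "factor_mset G x = fmset G fs"
proof -
  let ?gs = "SOME fs. set fs \<subseteq> carrier G \<and> wfactors G fs x"
  have "set ?gs \<subseteq> carrier G \<and> wfactors G ?gs x"
    using assms(2,3) by (intro someI) blast
  with assms show ?thesis
    unfolding factor_mset_def by (meson ee_fmset wfactors_unique)
qed

lemma factor_mset_mult:
  assumes "x \<in> carrier G" "y \<in> carrier G"
  shows "factor_mset G (x \<otimes> y) = factor_mset G x + factor_mset G y"
proof -
  obtain xs where xs: "set xs \<subseteq> carrier G" "wfactors G xs x"
    using wfactors_exist assms(1) by blast
  obtain ys where ys: "set ys \<subseteq> carrier G" "wfactors G ys y"
    using wfactors_exist assms(2) by blast
  obtain zs where zs: "set zs \<subseteq> carrier G" "wfactors G zs (x \<otimes> y)"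
    using wfactors_exist assms by blast
  show ?thesis
    using mult_wfactors_fmset[OF xs(2) ys(2) zs(2) assms xs(1) ys(1) zs(1)] assms xs ys zs
    by (simp add: factor_mset_eq)
qed

lemma divides_iff_factor_mset:
  assumes "x \<in> carrier G" "y \<in> carrier G"
  shows "x divides y \<longleftrightarrow> factor_mset G x \<subseteq># factor_mset G y"
proof -
  obtain xs where xs: "set xs \<subseteq> carrier G" "wfactors G xs x"
    using wfactors_exist assms(1) by blast
  obtain ys where ys: "set ys \<subseteq> carrier G" "wfactors G ys y"
    using wfactors_exist assms(2) by blast
  show ?thesis
    using divides_as_fmsubset[OF xs(2) ys(2) assms xs(1) ys(1)] assms xs ys
    by (simp add: factor_mset_eq)
qed

lemma factor_mset_pow:
  assumes "x \<in> carrier G"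
  shows "factor_mset G (x [^] (n::nat)) = repeat_mset n (factor_mset G x)"
proof (induction n)
  case 0
  show ?case using factor_mset_mult[of \<one> \<one>] by simp
next
  case (Suc n)
  then show ?case using assms by (simp add: factor_mset_mult)
qed

lemma ex_factor_mset_union:
  assumes "x \<in> carrier G" "y \<in> carrier G"
  shows "\<exists>z\<in>carrier G. factor_mset G z = factor_mset G x \<union># factor_mset G y"
proof -
  obtain xs where xs: "set xs \<subseteq> carrier G" "wfactors G xs x"
    using wfactors_exist assms(1) by blast
  obtain ys where ys: "set ys \<subseteq> carrier G" "wfactors G ys y"
    using wfactors_exist assms(2) by blast
  have "\<exists>z zs. z \<in> carrier G \<and> set zs \<subseteq> carrier G \<and> wfactors G zs z \<and>
          fmset G zs = fmset G xs \<union># fmset G ys"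
  proof (rule mset_wfactorsEx)
    fix X assume "X \<in># fmset G xs \<union># fmset G ys"
    then obtain q where "q \<in> set xs \<union> set ys" "X = assocs G q"
      by (auto simp: fmset_def)
    with xs ys show "\<exists>q. (q \<in> carrier G \<and> irreducible G q) \<and> X = assocs G q"
      by (auto simp: wfactors_def)
  qed
  with assms xs ys show ?thesis by (metis factor_mset_eq)
qed

end


section \<open>Monomials in two indeterminates\<close>

context cring
begin

lemma UP2_cring: "cring (UP2 R)"
proof -
  interpret P: UP_cring R "UP R" by unfold_locales simp
  interpret Q: UP_cring "UP R" "UP2 R" by unfold_locales simp
  show ?thesis by (rule Q.P.cring_axioms)
qed

lemma monom2_closed: "a \<in> carrier R \<Longrightarrow> monom2 R a r s \<in> carrier (UP2 R)"
proof -
  interpret P: UP_cring R "UP R" by unfold_locales simp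
  interpret Q: UP_cring "UP R" "UP2 R" by unfold_locales simp
  show "a \<in> carrier R \<Longrightarrow> monom2 R a r s \<in> carrier (UP2 R)"
    by (simp add: monom2_def)
qed

lemma monom2_zero: "monom2 R \<zero> r s = \<zero>\<^bsub>UP2 R\<^esub>"
proof -
  interpret P: UP_cring R "UP R" by unfold_locales simp
  interpret Q: UP_cring "UP R" "UP2 R" by unfold_locales simp
  show ?thesis by (simp add: monom2_def)
qed

lemma monom2_one: "monom2 R \<one> 0 0 = \<one>\<^bsub>UP2 R\<^esub>"
proof -
  interpret P: UP_cring R "UP R" by unfold_locales simp
  interpret Q: UP_cring "UP R" "UP2 R" by unfold_locales simp
  show ?thesis by (simp add: monom2_def)
qed

lemma monom2_a_inv: "a \<in> carrier R \<Longrightarrow> monom2 R (\<ominus> a) r s = \<ominus>\<^bsub>UP2 R\<^esub> monom2 R a r s"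
proof -
  interpret P: UP_cring R "UP R" by unfold_locales simp
  interpret Q: UP_cring "UP R" "UP2 R" by unfold_locales simp
  show "a \<in> carrier R \<Longrightarrow> ?thesis" by (simp add: monom2_def)
qed

lemma monom2_add:
  "a \<in> carrier R \<Longrightarrow> b \<in> carrier R \<Longrightarrow>
    monom2 R (a \<oplus> b) r s = monom2 R a r s \<oplus>\<^bsub>UP2 R\<^esub> monom2 R b r s"
proof -
  interpret P: UP_cring R "UP R" by unfold_locales simp
  interpret Q: UP_cring "UP R" "UP2 R" by unfold_locales simp
  show "a \<in> carrier R \<Longrightarrow> b \<in> carrier R \<Longrightarrow> ?thesis" by (simp add: monom2_def)
qed

lemma monom2_mult:
  "a \<in> carrier R \<Longrightarrow> b \<in> carrier R \<Longrightarrow>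
    monom2 R (a \<otimes> b) (r + r') (s + s') = monom2 R a r s \<otimes>\<^bsub>UP2 R\<^esub> monom2 R b r' s'"
proof -
  interpret P: UP_cring R "UP R" by unfold_locales simp
  interpret Q: UP_cring "UP R" "UP2 R" by unfold_locales simp
  show "a \<in> carrier R \<Longrightarrow> b \<in> carrier R \<Longrightarrow> ?thesis" by (simp add: monom2_def)
qed

end

section \<open>Bigraded subalgebras given by ideals\<close>

lemma (in abelian_monoid) finsum_in_submonoid:
  assumes "finite F" "\<And>x. x \<in> F \<Longrightarrow> f x \<in> E"
    and "E \<subseteq> carrier G" "\<zero> \<in> E" "\<And>p q. p \<in> E \<Longrightarrow> q \<in> E \<Longrightarrow> p \<oplus> q \<in> E"
  shows "finsum G f F \<in> E"
  using assms(1,2)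
proof (induction F)
  case empty
  show ?case using assms(4) by simp
next
  case (insert x F)
  then show ?case using assms(3,5) by (subst finsum_insert) auto
qed

text \<open>
  The properties of the family \<open>K r s = I\<^sup>r \<inter> J\<^sup>s\<close> that make \<open>\<Sum> K r s u\<^sup>r v\<^sup>s\<close> a subalgebra
  of \<open>R[u,v]\<close>.
\<close>

locale bigraded_ideals = cring R for R (structure) +
  fixes K :: "nat \<Rightarrow> nat \<Rightarrow> 'a set"
  assumes K_ideal: "ideal (K r s) R"
    and K_0_0: "K 0 0 = carrier R"
    and K_mult: "x \<in> K r s \<Longrightarrow> y \<in> K r' s' \<Longrightarrow> x \<otimes> y \<in> K (r + r') (s + s')"
begin

definition bigraded_sum :: "(nat \<Rightarrow> nat \<Rightarrow> 'a) set" where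
  "bigraded_sum = {finsum (UP2 R) (\<lambda>(r, s). monom2 R (c r s) r s) F | F c.
     finite F \<and> (\<forall>(r, s)\<in>F. c r s \<in> K r s)}"

lemma K_closed: "x \<in> K r s \<Longrightarrow> x \<in> carrier R"
  using ideal.Icarr[OF K_ideal] .

lemma K_zero: "\<zero> \<in> K r s"
  using additive_subgroup.zero_closed[OF ideal.axioms(1)[OF K_ideal]] .

lemma K_add: "x \<in> K r s \<Longrightarrow> y \<in> K r s \<Longrightarrow> x \<oplus> y \<in> K r s"
  using additive_subgroup.a_closed[OF ideal.axioms(1)[OF K_ideal]] .

lemma monom2_in_bigraded_sum:
  assumes "x \<in> K r s"
  shows "monom2 R x r s \<in> bigraded_sum"
proof -
  interpret Q: cring "UP2 R" by (rule UP2_cring)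
  have "finsum (UP2 R) (\<lambda>(r, s). monom2 R x r s) {(r, s)} = monom2 R x r s"
    using assms by (subst Q.finsum_insert) (auto simp: monom2_closed K_closed)
  moreover have "finsum (UP2 R) (\<lambda>(r, s). monom2 R x r s) {(r, s)} \<in> bigraded_sum"
    unfolding bigraded_sum_def using assms by (intro CollectI exI[of _ "{(r, s)}"] exI[of _ "\<lambda>_ _. x"]) auto
  ultimately show ?thesis by simp
qed

lemma bigraded_sum_closed: "p \<in> bigraded_sum \<Longrightarrow> p \<in> carrier (UP2 R)"
proof -
  interpret Q: cring "UP2 R" by (rule UP2_cring)
  show "p \<in> bigraded_sum \<Longrightarrow> p \<in> carrier (UP2 R)"
    unfolding bigraded_sum_def by (auto intro!: Q.finsum_closed monom2_closed K_closed)
qed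

lemma bigraded_sum_add:
  assumes "p \<in> bigraded_sum" "q \<in> bigraded_sum"
  shows "p \<oplus>\<^bsub>UP2 R\<^esub> q \<in> bigraded_sum"
proof -
  interpret Q: cring "UP2 R" by (rule UP2_cring)
  obtain F c where p: "p = finsum (UP2 R) (\<lambda>(r, s). monom2 R (c r s) r s) F"
    and F: "finite F" "\<forall>(r, s)\<in>F. c r s \<in> K r s"
    using assms(1) unfolding bigraded_sum_def by blast
  obtain G d where q: "q = finsum (UP2 R) (\<lambda>(r, s). monom2 R (d r s) r s) G"
    and G: "finite G" "\<forall>(r, s)\<in>G. d r s \<in> K r s"
    using assms(2) unfolding bigraded_sum_def by blast
  \<comment> \<open>Extending the coefficients by zero puts both sums over the same set of bidegrees.\<close>
  define c' where "c' r s = (if (r, s) \<in> F then c r s else \<zero>)" for r s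
  define d' where "d' r s = (if (r, s) \<in> G then d r s else \<zero>)" for r s
  have c': "c' r s \<in> K r s" for r s using F(2) K_zero by (auto simp: c'_def)
  have d': "d' r s \<in> K r s" for r s using G(2) K_zero by (auto simp: d'_def)
  note closed = c'[THEN K_closed] d'[THEN K_closed]
  have p': "p = finsum (UP2 R) (\<lambda>(r, s). monom2 R (c' r s) r s) (F \<union> G)"
    unfolding p using F G closed
    by (intro Q.add.finprod_mono_neutral_cong_left)
      (auto simp: c'_def monom2_zero monom2_closed K_closed)
  have q': "q = finsum (UP2 R) (\<lambda>(r, s). monom2 R (d' r s) r s) (F \<union> G)"
    unfolding q using F G closed
    by (intro Q.add.finprod_mono_neutral_cong_left)
      (auto simp: d'_def monom2_zero monom2_closed K_closed)
  have "p \<oplus>\<^bsub>UP2 R\<^esub> q =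
      finsum (UP2 R) (\<lambda>x. (\<lambda>(r, s). monom2 R (c' r s) r s) x \<oplus>\<^bsub>UP2 R\<^esub> (\<lambda>(r, s). monom2 R (d' r s) r s) x) (F \<union> G)"
    unfolding p' q' using closed
    by (intro Q.finsum_addf[symmetric]) (auto simp: monom2_closed)
  also have "\<dots> = finsum (UP2 R) (\<lambda>(r, s). monom2 R (c' r s \<oplus> d' r s) r s) (F \<union> G)"
    by (rule Q.finsum_cong') (auto simp: monom2_add monom2_closed closed)
  also have "\<dots> \<in> bigraded_sum"
    unfolding bigraded_sum_def using F(1) G(1)
    by (intro CollectI exI[of _ "F \<union> G"] exI[of _ "\<lambda>r s. c' r s \<oplus> d' r s"]) (auto intro: K_add c' d')
  finally show ?thesis .
qed

lemma bigraded_sum_mult: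
  assumes "p \<in> bigraded_sum" "q \<in> bigraded_sum"
  shows "p \<otimes>\<^bsub>UP2 R\<^esub> q \<in> bigraded_sum"
proof -
  interpret Q: cring "UP2 R" by (rule UP2_cring)
  obtain F c where p: "p = finsum (UP2 R) (\<lambda>(r, s). monom2 R (c r s) r s) F"
    and F: "finite F" "\<forall>(r, s)\<in>F. c r s \<in> K r s"
    using assms(1) unfolding bigraded_sum_def by blast
  obtain G d where q: "q = finsum (UP2 R) (\<lambda>(r, s). monom2 R (d r s) r s) G"
    and G: "finite G" "\<forall>(r, s)\<in>G. d r s \<in> K r s"
    using assms(2) unfolding bigraded_sum_def by blast
  have sub: "bigraded_sum \<subseteq> carrier (UP2 R)" using bigraded_sum_closed by blast
  have zero: "\<zero>\<^bsub>UP2 R\<^esub> \<in> bigraded_sum"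
    using monom2_in_bigraded_sum[OF K_zero, of 0 0] by (simp add: monom2_zero)
  have m: "monom2 R (c r s) r s \<otimes>\<^bsub>UP2 R\<^esub> q \<in> bigraded_sum" if "(r, s) \<in> F" for r s
  proof -
    have c: "c r s \<in> K r s" using that F(2) by blast
    have "monom2 R (c r s) r s \<otimes>\<^bsub>UP2 R\<^esub> q =
        finsum (UP2 R) (\<lambda>x. monom2 R (c r s) r s \<otimes>\<^bsub>UP2 R\<^esub> (\<lambda>(r, s). monom2 R (d r s) r s) x) G"
      unfolding q using c G by (intro Q.finsum_rdistr) (auto intro!: monom2_closed K_closed)
    also have "\<dots> \<in> bigraded_sum"
      using G sub zero bigraded_sum_add c
      by (intro Q.finsum_in_submonoid)
        (auto simp: monom2_mult[symmetric] K_closed intro!: monom2_in_bigraded_sum K_mult)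
    finally show ?thesis .
  qed
  have "p \<otimes>\<^bsub>UP2 R\<^esub> q = finsum (UP2 R) (\<lambda>x. (\<lambda>(r, s). monom2 R (c r s) r s) x \<otimes>\<^bsub>UP2 R\<^esub> q) F"
    unfolding p using F bigraded_sum_closed[OF assms(2)]
    by (intro Q.finsum_ldistr) (auto intro!: monom2_closed K_closed)
  also have "\<dots> \<in> bigraded_sum"
    using F sub zero bigraded_sum_add m
    by (intro Q.finsum_in_submonoid) auto
  finally show ?thesis .
qed

lemma subring_bigraded_sum: "subring bigraded_sum (UP2 R)"
proof -
  interpret Q: cring "UP2 R" by (rule UP2_cring)
  have const: "monom2 R a 0 0 \<in> bigraded_sum" if "a \<in> carrier R" for a
    using that by (intro monom2_in_bigraded_sum) (simp add: K_0_0)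
  show ?thesis
  proof (rule Q.subringI)
    show "\<one>\<^bsub>UP2 R\<^esub> \<in> bigraded_sum"
      using const[of \<one>] by (simp add: monom2_one)
    show "\<ominus>\<^bsub>UP2 R\<^esub> p \<in> bigraded_sum" if p: "p \<in> bigraded_sum" for p
    proof -
      have "\<ominus>\<^bsub>UP2 R\<^esub> p = monom2 R (\<ominus> \<one>) 0 0 \<otimes>\<^bsub>UP2 R\<^esub> p"
        using bigraded_sum_closed[OF p] by (simp add: monom2_a_inv monom2_one Q.l_minus)
      also have "\<dots> \<in> bigraded_sum"
        by (intro bigraded_sum_mult const p) simp
      finally show ?thesis .
    qed
  qed (auto intro: bigraded_sum_closed bigraded_sum_add bigraded_sum_mult)
qed

text \<open>
  If the ideals are principal, the algebra is generated over \<open>R\<close> by the monomials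
  \<open>g r s u\<^sup>r v\<^sup>s\<close>. Each nonconstant one with bidegree outside \<open>H\<close> is an \<open>R\<close>-multiple of a product of
  two of smaller total degree. Hence those with bidegree in \<open>H\<close> suffice.
\<close>
lemma finitely_generated_bigraded_sum:
  assumes g: "\<And>r s. g r s \<in> carrier R" "\<And>r s. K r s = PIdl (g r s)"
    and "finite H"
    and split: "\<And>r s. \<lbrakk>(r, s) \<notin> H; (r, s) \<noteq> (0, 0)\<rbrakk> \<Longrightarrow>
           \<exists>r1 s1 r2 s2. (r1, s1) \<noteq> (0, 0) \<and> (r2, s2) \<noteq> (0, 0) \<and>
             r = r1 + r2 \<and> s = s1 + s2 \<and> g r1 s1 \<otimes> g r2 s2 divides g r s"
  shows "finitely_generated_algebra R bigraded_sum"
proof -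
  interpret Q: cring "UP2 R" by (rule UP2_cring)
  define S where "S = (\<lambda>(r, s). monom2 R (g r s) r s) ` H"
  let ?C = "(\<lambda>a. monom2 R a 0 0) ` carrier R"
  define E where "E = subalgebra_generated R S"
  have gK: "g r s \<in> K r s" for r s
    using g by (simp add: cgenideal_self)
  have S: "S \<subseteq> bigraded_sum"
    unfolding S_def using gK by (auto intro: monom2_in_bigraded_sum)
  have C: "?C \<subseteq> bigraded_sum"
    by (auto intro: monom2_in_bigraded_sum simp: K_0_0)
  have gen: "?C \<union> S \<subseteq> carrier (UP2 R)"
    using S C bigraded_sum_closed by blast
  have E: "subring E (UP2 R)"
    unfolding E_def subalgebra_generated_def by (rule Q.generate_ring_is_subring[OF gen])
  have const: "monom2 R a 0 0 \<in> E" if "a \<in> carrier R" for a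
    using that unfolding E_def subalgebra_generated_def by (intro generate_ring.incl) blast
  have scale: "monom2 R x r s \<in> E" if "monom2 R (g r s) r s \<in> E" "x \<in> K r s" for x r s
  proof -
    obtain y where y: "y \<in> carrier R" "x = y \<otimes> g r s"
      using \<open>x \<in> K r s\<close> g(2) unfolding cgenideal_def by blast
    then show ?thesis
      using monom2_mult[of y "g r s" 0 r 0 s] g(1) subringE(6)[OF E const that(1)] by simp
  qed
  have gE: "monom2 R (g r s) r s \<in> E" for r s
  proof (induction "r + s" arbitrary: r s rule: less_induct)
    case less
    consider "(r, s) = (0, 0)" | "(r, s) \<in> H" | "(r, s) \<notin> H" "(r, s) \<noteq> (0, 0)" by blast
    then show ?case
    proof cases
      case 1
      then show ?thesis using const g(1) by simp
    next
      case 2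
      then show ?thesis
        unfolding E_def subalgebra_generated_def S_def by (intro generate_ring.incl) force
    next
      case 3
      from split[OF this] obtain r1 s1 r2 s2 where rs: "(r1, s1) \<noteq> (0, 0)" "(r2, s2) \<noteq> (0, 0)"
        "r = r1 + r2" "s = s1 + s2" and "g r1 s1 \<otimes> g r2 s2 divides g r s"
        by blast
      then obtain c where c: "c \<in> carrier R" "g r s = (g r1 s1 \<otimes> g r2 s2) \<otimes> c"
        by (auto simp: factor_def)
      have "monom2 R (g r1 s1) r1 s1 \<in> E" "monom2 R (g r2 s2) r2 s2 \<in> E"
        using rs by (auto intro!: less)
      then have "monom2 R (g r1 s1) r1 s1 \<otimes>\<^bsub>UP2 R\<^esub> monom2 R (g r2 s2) r2 s2 \<otimes>\<^bsub>UP2 R\<^esub> monom2 R c 0 0 \<in> E"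
        using const c(1) by (intro subringE(6)[OF E])
      then show ?thesis
        using c g(1) rs(3,4) monom2_mult[of "g r1 s1 \<otimes> g r2 s2" c r 0 s 0] by (simp add: monom2_mult)
    qed
  qed
  have "bigraded_sum \<subseteq> E"
  proof
    fix p assume "p \<in> bigraded_sum"
    then obtain F c where p: "p = finsum (UP2 R) (\<lambda>(r, s). monom2 R (c r s) r s) F"
      and F: "finite F" "\<forall>(r, s)\<in>F. c r s \<in> K r s"
      unfolding bigraded_sum_def by blast
    show "p \<in> E"
      unfolding p using F scale gE subringE(1,2,7)[OF E]
      by (intro Q.finsum_in_submonoid) auto
  qed
  moreover have "E \<subseteq> bigraded_sum"
    unfolding E_def subalgebra_generated_def
    using S C by (intro Q.generate_ring_min_subring1 gen subring_bigraded_sum) blast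
  ultimately show ?thesis
    unfolding finitely_generated_algebra_def using \<open>finite H\<close> S
    by (intro exI[of _ S]) (auto simp: E_def S_def)
qed

end

section \<open>Powers of ideals\<close>

context cring
begin

lemma ideal_pow_0: "ideal_pow R I 0 = carrier R"
  by (simp add: ideal_pow_def nat_pow_def ideals_set_def)

lemma ideal_pow_Suc: "ideal_pow R I (Suc n) = ideal_pow R I n \<cdot> I"
  by (simp add: ideal_pow_def nat_pow_def ideals_set_def)

lemma ideal_pow_ideal:
  assumes "ideal I R"
  shows "ideal (ideal_pow R I n) R"
proof -
  interpret M: comm_monoid "ideals_set R" by (rule ideals_set_is_comm_monoid)
  show ?thesis
    using M.nat_pow_closed[of I n] assms by (simp add: ideal_pow_def ideals_set_def)
qed

lemma ideal_pow_mult: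
  assumes "ideal I R" "x \<in> ideal_pow R I m" "y \<in> ideal_pow R I n"
  shows "x \<otimes> y \<in> ideal_pow R I (m + n)"
proof -
  interpret M: comm_monoid "ideals_set R" by (rule ideals_set_is_comm_monoid)
  have "I \<in> carrier (ideals_set R)"
    using assms(1) by (simp add: ideals_set_def)
  from M.nat_pow_mult[OF this, of m n]
  have "ideal_pow R I m \<cdot> ideal_pow R I n = ideal_pow R I (m + n)"
    unfolding ideal_pow_def by (simp add: ideals_set_def)
  then show ?thesis
    using ideal_prod.prod[OF assms(2,3), of R] by simp
qed

lemma bigraded_ideals_ideal_pow:
  assumes "ideal I R" "ideal J R"
  shows "bigraded_ideals R (\<lambda>r s. ideal_pow R I r \<inter> ideal_pow R J s)"
proof (intro bigraded_ideals.intro bigraded_ideals_axioms.intro cring_axioms)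
  show "ideal (ideal_pow R I r \<inter> ideal_pow R J s) R" for r s
    using assms by (intro i_intersect ideal_pow_ideal)
  show "ideal_pow R I 0 \<inter> ideal_pow R J 0 = carrier R"
    by (simp add: ideal_pow_0)
qed (use assms in \<open>auto intro: ideal_pow_mult\<close>)

lemma ideal_pow_PIdl:
  assumes "a \<in> carrier R"
  shows "ideal_pow R (PIdl a) n = PIdl (a [^] n)"
proof (induction n)
  case 0
  have "PIdl \<one> = carrier R" using ideal_eq_carrier_iff[of \<one>] by simp
  then show ?case by (simp add: ideal_pow_0)
next
  case (Suc n)
  have "ideal_pow R (PIdl a) (Suc n) = ideal_pow R (PIdl a) n \<cdot> (PIdl a)"
    by (rule ideal_pow_Suc)
  also have "\<dots> = Idl (PIdl (a [^] n) <#> PIdl a)"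
    unfolding Suc using assms by (intro ideal_prod_eq_genideal cgenideal_ideal) auto
  also have "\<dots> = Idl (PIdl (a [^] Suc n))"
    using assms by (simp add: cgenideal_prod)
  also have "\<dots> = PIdl (a [^] Suc n)"
  proof (rule subset_antisym)
    have I: "ideal (PIdl (a [^] Suc n)) R"
      using assms by (intro cgenideal_ideal nat_pow_closed)
    then show "Idl (PIdl (a [^] Suc n)) \<subseteq> PIdl (a [^] Suc n)"
      by (rule genideal_minimal) simp
    show "PIdl (a [^] Suc n) \<subseteq> Idl (PIdl (a [^] Suc n))"
      using ideal.Icarr[OF I] by (intro genideal_self) blast
  qed
  finally show ?case .
qed

lemma mem_PIdl_iff_divides:
  assumes "a \<in> carrier R"
  shows "x \<in> PIdl a \<longleftrightarrow> a divides x"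
  unfolding cgenideal_def factor_def using m_comm[OF assms] by auto

end

section \<open>Intersection algebras of principal ideals\<close>

text \<open>
  The generator of \<open>(a\<^sup>r) \<inter> (b\<^sup>s)\<close> is an element whose factorization is the union of those of
  \<open>a\<^sup>r\<close> and \<open>b\<^sup>s\<close>; a splitting of these unions as sums is a splitting of the generators as
  products, up to units.
\<close>

lemma (in factorial_domain) intersection_algebra_nonzero_generators:
  assumes a: "a \<in> carrier R" "a \<noteq> \<zero>" and b: "b \<in> carrier R" "b \<noteq> \<zero>"
  shows "finitely_generated_algebra R (intersection_algebra R (PIdl a) (PIdl b))"
proof -
  let ?\<mu> = "factor_mset (mult_of R)"
  let ?K = "\<lambda>r s. ideal_pow R (PIdl a) r \<inter> ideal_pow R (PIdl b) s"
  define L where "L = (\<lambda>r s. repeat_mset r (?\<mu> a) \<union># repeat_mset s (?\<mu> b))"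
  interpret K: bigraded_ideals R ?K
    using a b by (intro bigraded_ideals_ideal_pow cgenideal_ideal)
  have pow: "a [^] r \<in> carrier (mult_of R)" "?\<mu> (a [^] r) = repeat_mset r (?\<mu> a)"
       "b [^] r \<in> carrier (mult_of R)" "?\<mu> (b [^] r) = repeat_mset r (?\<mu> b)" for r :: nat
    using mult_of.nat_pow_closed[of a r] factor_mset_pow[of a r]
      mult_of.nat_pow_closed[of b r] factor_mset_pow[of b r] a b
    by (simp_all add: nat_pow_mult_of)
  have dvd: "x divides y \<longleftrightarrow> ?\<mu> x \<subseteq># ?\<mu> y"
    if "x \<in> carrier (mult_of R)" "y \<in> carrier (mult_of R)" for x y
  proof -
    have "x divides y \<longleftrightarrow> x divides\<^bsub>mult_of R\<^esub> y"
      using that divides_imp_divides_mult[of x y] divides_mult_imp_divides[of R x y]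
      unfolding carrier_mult_of by blast
    then show ?thesis
      using divides_iff_factor_mset[OF that] by blast
  qed
  have "\<forall>r s. \<exists>z\<in>carrier (mult_of R). ?\<mu> z = L r s"
    using ex_factor_mset_union pow unfolding L_def by metis
  then obtain g where g: "\<And>r s. g r s \<in> carrier (mult_of R)" "\<And>r s. ?\<mu> (g r s) = L r s"
    by metis
  have gen: "?K r s = PIdl (g r s)" for r s
  proof -
    \<comment> \<open>Factorizations exist for nonzero elements only; zero lies in every ideal.\<close>
    have "x \<in> ?K r s \<longleftrightarrow> x \<in> PIdl (g r s)" for x
    proof (cases "x \<in> carrier R - {\<zero>}")
      case True
      have "a [^] r divides x \<and> b [^] s divides x \<longleftrightarrow> g r s divides x"
        using dvd[OF pow(1), of x r] dvd[OF pow(3), of x s] dvd[OF g(1), of x r s] True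
        by (simp add: pow(2,4) g(2) L_def)
      then show ?thesis
        using a b g by (simp add: ideal_pow_PIdl mem_PIdl_iff_divides)
    next
      case False
      have "x = \<zero> \<or> x \<notin> carrier R" using False by blast
      then show ?thesis
      proof
        assume "x = \<zero>"
        then show ?thesis
          using a b g by (simp add: ideal_pow_PIdl mem_PIdl_iff_divides divides_zero)
      next
        assume "x \<notin> carrier R"
        then show ?thesis
          using K.K_closed[of x r s] ideal.Icarr[OF cgenideal_ideal, of "g r s" x] g(1)[of r s]
          unfolding carrier_mult_of by blast
      qed
    qed
    then show ?thesis by blast
  qed
  obtain H where H: "finite H"
    and split: "\<And>r s. \<lbrakk>(r, s) \<notin> H; (r, s) \<noteq> (0, 0)\<rbrakk> \<Longrightarrow>
           \<exists>r1 s1 r2 s2. (r1, s1) \<noteq> (0, 0) \<and> (r2, s2) \<noteq> (0, 0) \<and>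
             r = r1 + r2 \<and> s = s1 + s2 \<and> L r s = L r1 s1 + L r2 s2"
    using union_repeat_mset_decomposition unfolding L_def by blast
  have L_dvd: "g r1 s1 \<otimes> g r2 s2 divides g r s" if "L r s = L r1 s1 + L r2 s2" for r s r1 s1 r2 s2
    using that g factor_mset_mult[of "g r1 s1" "g r2 s2"] mult_of.m_closed[of "g r1 s1" "g r2 s2"]
    by (subst dvd) auto
  have "finitely_generated_algebra R K.bigraded_sum"
  proof (rule K.finitely_generated_bigraded_sum[of g H])
    fix r s assume "(r, s) \<notin> H" "(r, s) \<noteq> (0, 0)"
    from split[OF this] obtain r1 s1 r2 s2 where "(r1, s1) \<noteq> (0, 0)" "(r2, s2) \<noteq> (0, 0)"
      "r = r1 + r2" "s = s1 + s2" "L r s = L r1 s1 + L r2 s2" by blast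
    moreover from this(5) have "g r1 s1 \<otimes> g r2 s2 divides g r s" by (rule L_dvd)
    ultimately show "\<exists>r1 s1 r2 s2. (r1, s1) \<noteq> (0, 0) \<and> (r2, s2) \<noteq> (0, 0) \<and>
             r = r1 + r2 \<and> s = s1 + s2 \<and> g r1 s1 \<otimes> g r2 s2 divides g r s"
      by blast
  qed (use g H gen in auto)
  then show ?thesis
    by (simp add: K.bigraded_sum_def intersection_algebra_def)
qed

text \<open>
  Powers of zero are only \<open>1\<close> and \<open>0\<close>, and intersecting an ideal with \<open>(1)\<close> or \<open>(0)\<close> is the same as
  multiplying its generator by \<open>1\<close> or \<open>0\<close>. Thus intersection becomes product, and the
  generator \<open>a\<^sup>r b\<^sup>s\<close> is multiplicative in \<open>(r, s)\<close>.
\<close>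
lemma (in cring) intersection_algebra_zero_generator:
  assumes a: "a \<in> carrier R" and b: "b \<in> carrier R" and "a = \<zero> \<or> b = \<zero>"
  shows "finitely_generated_algebra R (intersection_algebra R (PIdl a) (PIdl b))"
proof -
  let ?K = "\<lambda>r s. ideal_pow R (PIdl a) r \<inter> ideal_pow R (PIdl b) s"
  define g where "g r s = a [^] r \<otimes> b [^] s" for r s :: nat
  interpret K: bigraded_ideals R ?K
    using a b by (intro bigraded_ideals_ideal_pow cgenideal_ideal)
  have g_closed: "g r s \<in> carrier R" for r s using a b by (simp add: g_def)
  have zero_pow: "\<zero> [^] n = (if n = 0 then \<one> else \<zero>)" for n :: nat
    by (simp add: nat_pow_zero)
  have one: "PIdl \<one> = carrier R" using ideal_eq_carrier_iff[of \<one>] by simp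
  have zero: "PIdl \<zero> = {\<zero>}" by (auto simp: cgenideal_def intro!: exI[of _ \<zero>])
  have inter: "PIdl x \<inter> PIdl y = PIdl (x \<otimes> y)"
    if "x = \<zero> \<or> x = \<one>" "y \<in> carrier R" for x y
  proof -
    have "PIdl y \<subseteq> carrier R" "\<zero> \<in> PIdl y"
      using ideal.Icarr[OF cgenideal_ideal[OF that(2)]] that(2)
        additive_subgroup.zero_closed[OF ideal.axioms(1)[OF cgenideal_ideal[OF that(2)]]] by blast+
    then have "carrier R \<inter> PIdl y = PIdl y" "{\<zero>} \<inter> PIdl y = {\<zero>}" by blast+
    with that show ?thesis by (elim disjE) (simp_all add: one zero)
  qed
  have gen: "?K r s = PIdl (g r s)" for r s
  proof (cases "a = \<zero>")
    case True
    then have "a [^] r = \<zero> \<or> a [^] r = \<one>" by (simp add: zero_pow)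
    from inter[OF this, of "b [^] s"] show ?thesis
      using a b by (simp add: ideal_pow_PIdl g_def)
  next
    case False
    with assms(3) have "b [^] s = \<zero> \<or> b [^] s = \<one>" by (simp add: zero_pow)
    from inter[OF this, of "a [^] r"] show ?thesis
      using a b m_comm[of "a [^] r" "b [^] s"] by (simp add: ideal_pow_PIdl g_def Int_commute)
  qed
  have g_add: "g (r1 + r2) (s1 + s2) = g r1 s1 \<otimes> g r2 s2" for r1 r2 s1 s2
    using a b by (simp add: g_def nat_pow_mult[symmetric] m_ac)
  have "finitely_generated_algebra R K.bigraded_sum"
  proof (rule K.finitely_generated_bigraded_sum[of g "{(1, 0), (0, 1)}"])
    fix r s :: nat assume rs: "(r, s) \<notin> {(1, 0), (0, 1)}" "(r, s) \<noteq> (0, 0)"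
    have "\<exists>r1 s1 r2 s2. (r1, s1) \<noteq> (0, 0) \<and> (r2, s2) \<noteq> (0, 0) \<and> r = r1 + r2 \<and> s = s1 + s2"
    proof (cases r)
      case 0
      with rs show ?thesis by (intro exI[of _ 0] exI[of _ 1] exI[of _ 0] exI[of _ "s - 1"]) auto
    next
      case (Suc r')
      with rs show ?thesis by (intro exI[of _ 1] exI[of _ 0] exI[of _ r'] exI[of _ s]) auto
    qed
    then show "\<exists>r1 s1 r2 s2. (r1, s1) \<noteq> (0, 0) \<and> (r2, s2) \<noteq> (0, 0) \<and>
             r = r1 + r2 \<and> s = s1 + s2 \<and> g r1 s1 \<otimes> g r2 s2 divides g r s"
      using g_add g_closed by (metis divides_refl)
  qed (use g_closed gen in auto)
  then show ?thesis
    by (simp add: K.bigraded_sum_def intersection_algebra_def)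
qed

theorem theorem2p1:
  fixes R (structure) and I J :: "'a set"
  assumes "noetherian_ring R"
    and "factorial_domain R"
    and "principalideal I R"
    and "principalideal J R"
  shows "finitely_generated_algebra R (intersection_algebra R I J)"
proof -
  interpret factorial_domain R by fact
  obtain a where a: "a \<in> carrier R" "I = PIdl a"
    using principalideal.generate[OF assms(3)] cgenideal_eq_genideal by auto
  obtain b where b: "b \<in> carrier R" "J = PIdl b"
    using principalideal.generate[OF assms(4)] cgenideal_eq_genideal by auto
  show ?thesis
    using a b intersection_algebra_nonzero_generators intersection_algebra_zero_generator by blast
qed

end
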